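(* Let $g \ge 2$ and let $\Gamma_g$ be the fundamental group of a closed orientable surface of genus $g$. Let $G$ be a residually nilpotent group with $G/\gamma_k(G) \cong \Gamma_g/\gamma_k(\Gamma_g)$ for all $k \ge 1$. Then no finite-index subgroup of $G$ is free.
   Context: $\gamma_k$ denotes the lower central series: $\gamma_1(G)=G$, $\gamma_k(G)=[G,\gamma_{k-1}(G)]$. A group is residually nilpotent if the intersection of its lower central series is trivial. Such a $G$ is called a ($g$-)parasurface group. *)

theory Defs
  imports "HOL-Algebra.Algebra"
begin

section \<open>Words and finitely/arbitrarily presented groups\<close>

text \<open>A word over an alphabet of generators: a list of letters (b, x), where
  (True, x) stands for the generator x and (False, x) for its inverse.\<close>
type_synonym 'a word = "(bool \<times> 'a) list"

text \<open>Elementary moves: insert a cancelling pair x x^-1 or x^-1 x, or insert a relator.\<close>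
definition pres_step :: "'a word set \<Rightarrow> ('a word \<times> 'a word) set" where
  "pres_step R =
     {(u @ v, u @ [(b, x), (\<not> b, x)] @ v) | u v b x. True}
   \<union> {(u @ v, u @ r @ v) | u v r. r \<in> R}"

text \<open>The equivalence relation on words over S generated by the elementary moves.\<close>
definition pres_equiv :: "'a set \<Rightarrow> 'a word set \<Rightarrow> ('a word \<times> 'a word) set" where
  "pres_equiv S R =
     (((pres_step R \<union> (pres_step R)\<inverse>) \<inter> (lists (UNIV \<times> S) \<times> lists (UNIV \<times> S)))\<^sup>*)
     \<inter> (lists (UNIV \<times> S) \<times> lists (UNIV \<times> S))"

text \<open>The group with presentation < S | R >: equivalence classes of words,
  multiplication induced by concatenation.\<close>
definition presented_group :: "'a set \<Rightarrow> 'a word set \<Rightarrow> 'a word set monoid" where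
  "presented_group S R =
     \<lparr> carrier = lists (UNIV \<times> S) // pres_equiv S R,
       monoid.mult = (\<lambda>A B. pres_equiv S R `` {(SOME a. a \<in> A) @ (SOME b. b \<in> B)}),
       monoid.one = pres_equiv S R `` {[]} \<rparr>"

text \<open>The free group on the set S.\<close>
definition free_group :: "'a set \<Rightarrow> 'a word set monoid" where
  "free_group S = presented_group S {}"

text \<open>Surface group of genus g: generators a_i = 2i, b_i = 2i+1 (i < g),
  single relator [a_0,b_0] ... [a_(g-1),b_(g-1)].\<close>
definition surface_relator :: "nat \<Rightarrow> nat word" where
  "surface_relator g =
     concat (map (\<lambda>i. [(True, 2*i), (True, 2*i+1), (False, 2*i), (False, 2*i+1)]) [0..<g])"

definition surface_group :: "nat \<Rightarrow> nat word set monoid" where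
  "surface_group g = presented_group {..<2*g} {surface_relator g}"

section \<open>Lower central series\<close>

definition group_commutator :: "('a, 'b) monoid_scheme \<Rightarrow> 'a \<Rightarrow> 'a \<Rightarrow> 'a" where
  "group_commutator G x y = x \<otimes>\<^bsub>G\<^esub> y \<otimes>\<^bsub>G\<^esub> inv\<^bsub>G\<^esub> x \<otimes>\<^bsub>G\<^esub> inv\<^bsub>G\<^esub> y"

text \<open>[H, K]: the subgroup generated by commutators [h,k], h in H, k in K.\<close>
definition commutator_subgroup :: "('a, 'b) monoid_scheme \<Rightarrow> 'a set \<Rightarrow> 'a set \<Rightarrow> 'a set" where
  "commutator_subgroup G H K = generate G {group_commutator G h k | h k. h \<in> H \<and> k \<in> K}"

text \<open>lcs G n = gamma_(n+1)(G).\<close>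
primrec lcs :: "('a, 'b) monoid_scheme \<Rightarrow> nat \<Rightarrow> 'a set" where
  "lcs G 0 = carrier G"
| "lcs G (Suc n) = commutator_subgroup G (carrier G) (lcs G n)"

text \<open>gamma G k = gamma_k(G) for k >= 1 (gamma_1 = G, gamma_k = [G, gamma_(k-1)]).\<close>
definition gamma :: "('a, 'b) monoid_scheme \<Rightarrow> nat \<Rightarrow> 'a set" where
  "gamma G k = lcs G (k - 1)"

definition residually_nilpotent :: "('a, 'b) monoid_scheme \<Rightarrow> bool" where
  "residually_nilpotent G \<longleftrightarrow> (\<Inter>k\<in>{1..}. gamma G k) = {\<one>\<^bsub>G\<^esub>}"

end

theory Submission
  imports Defs
begin

text \<open>
  A free group has no second cohomology, and over the rationals transfer carries this over to every
  group \<open>G\<close> that contains a free subgroup \<open>H\<close> of finite index. So for additive characters \<open>x\<close> and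
  \<open>y\<close> of \<open>G\<close> the cocycle \<open>x u * y v\<close> is a coboundary: there is \<open>q\<close> with
  \<open>q (u v) = q u + q v + x u * y v\<close>. Such a \<open>q\<close> vanishes on \<open>\<gamma>\<^sub>3\<close> and takes the value
  \<open>x a * y b - x b * y a\<close> on the commutator of \<open>a\<close> and \<open>b\<close>. Let \<open>x\<close> and \<open>y\<close> correspond, under
  \<open>G/\<gamma>\<^sub>3(G) \<cong> \<Gamma>\<^sub>g/\<gamma>\<^sub>3(\<Gamma>\<^sub>g)\<close>, to the characters dual to the first two generators, and lift the generators
  to \<open>G\<close>. The product of their commutators lies in \<open>\<gamma>\<^sub>3(G)\<close>, yet \<open>q\<close> is 1 on it.
\<close>

section \<open>Presented groups\<close>

text \<open>By default \<open>auto\<close> turns membership in \<open>lists A\<close> into a statement about all letters, which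
  blocks conditional rewriting with lemmas about words over \<open>S\<close>.\<close>
declare in_listsD [rule del] in_listsI [rule del]

definition word_class :: "'a set \<Rightarrow> 'a word set \<Rightarrow> 'a word \<Rightarrow> 'a word set" where
  "word_class S R w = pres_equiv S R `` {w}"

definition pres_move :: "'a set \<Rightarrow> 'a word set \<Rightarrow> ('a word \<times> 'a word) set" where
  "pres_move S R =
     (pres_step R \<union> (pres_step R)\<inverse>) \<inter> (lists (UNIV \<times> S) \<times> lists (UNIV \<times> S))"

lemma pres_equiv_altdef:
  "pres_equiv S R = (pres_move S R)\<^sup>* \<inter> (lists (UNIV \<times> S) \<times> lists (UNIV \<times> S))"
  by (simp add: pres_equiv_def pres_move_def)

lemma equiv_pres_equiv: "equiv (lists (UNIV \<times> S)) (pres_equiv S R)"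
proof (rule equivI)
  have "sym (pres_move S R)"
    unfolding pres_move_def sym_def by blast
  then have "sym ((pres_move S R)\<^sup>*)"
    by (rule sym_rtrancl)
  then show "sym (pres_equiv S R)"
    unfolding pres_equiv_altdef sym_def by blast
  show "trans (pres_equiv S R)"
    unfolding pres_equiv_altdef by (auto intro!: transI)
qed (auto simp: pres_equiv_altdef refl_on_def)

lemma pres_step_cancel: "(u @ v, u @ [(b, x), (\<not> b, x)] @ v) \<in> pres_step R"
  unfolding pres_step_def by (rule UnI1) blast

lemma pres_step_relator: "r \<in> R \<Longrightarrow> (u @ v, u @ r @ v) \<in> pres_step R"
  unfolding pres_step_def by (rule UnI2) blast

lemma pres_step_context:
  assumes "(u, v) \<in> pres_step R"
  shows "(p @ u @ s, p @ v @ s) \<in> pres_step R"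
  using assms unfolding pres_step_def[of R]
proof (elim UnE CollectE exE conjE, goal_cases)
  case (1 u' v' b x)
  then show ?case
    using pres_step_cancel[of "p @ u'" "v' @ s" b x R] by (simp add: pres_step_def)
next
  case (2 u' v' r)
  then show ?case
    using pres_step_relator[of r R "p @ u'" "v' @ s"] by (simp add: pres_step_def)
qed

lemma pres_equiv_context:
  assumes "(u, v) \<in> pres_equiv S R" "p \<in> lists (UNIV \<times> S)" "s \<in> lists (UNIV \<times> S)"
  shows "(p @ u @ s, p @ v @ s) \<in> pres_equiv S R"
proof -
  have move: "(p @ a @ s, p @ b @ s) \<in> pres_move S R" if "(a, b) \<in> pres_move S R" for a b
    using that assms(2,3) unfolding pres_move_def by (auto intro: pres_step_context)
  have "(u, v) \<in> (pres_move S R)\<^sup>*"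
    using assms(1) by (simp add: pres_equiv_altdef)
  then have "(p @ u @ s, p @ v @ s) \<in> (pres_move S R)\<^sup>*"
    by (induction rule: rtrancl_induct) (auto intro: rtrancl_into_rtrancl move)
  then show ?thesis
    using assms unfolding pres_equiv_altdef by auto
qed

lemma pres_equiv_append:
  assumes "(u, u') \<in> pres_equiv S R" "(v, v') \<in> pres_equiv S R"
  shows "(u @ v, u' @ v') \<in> pres_equiv S R"
proof -
  have "u' \<in> lists (UNIV \<times> S)" "v \<in> lists (UNIV \<times> S)"
    using assms by (auto simp: pres_equiv_altdef)
  then have "(u @ v, u' @ v) \<in> pres_equiv S R" "(u' @ v, u' @ v') \<in> pres_equiv S R"
    using pres_equiv_context[OF assms(1), of "[]" v] pres_equiv_context[OF assms(2), of u' "[]"]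
    by auto
  then show ?thesis
    using equiv_pres_equiv by (meson equivE transE)
qed

lemma word_class_eqI: "(u, v) \<in> pres_equiv S R \<Longrightarrow> word_class S R u = word_class S R v"
  unfolding word_class_def by (rule equiv_class_eq[OF equiv_pres_equiv])

lemma word_class_step:
  assumes "(u, v) \<in> pres_step R" "u \<in> lists (UNIV \<times> S)" "v \<in> lists (UNIV \<times> S)"
  shows "word_class S R u = word_class S R v"
  using assms by (intro word_class_eqI) (auto simp: pres_equiv_altdef pres_move_def)

lemma carrier_presented_group:
  "carrier (presented_group S R) = word_class S R ` lists (UNIV \<times> S)"
  by (auto simp: presented_group_def quotient_def word_class_def)

lemma one_presented_group: "\<one>\<^bsub>presented_group S R\<^esub> = word_class S R []"
  by (simp add: presented_group_def word_class_def)

text \<open>Multiplication in \<open>presented_group\<close> picks representatives by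
  \<open>SOME\<close>; being equivalent to the original words, they can be replaced by them.\<close>

lemma some_word_class:
  assumes "w \<in> lists (UNIV \<times> S)"
  shows "(w, SOME v. v \<in> word_class S R w) \<in> pres_equiv S R"
proof -
  have "w \<in> word_class S R w"
    using assms by (auto simp: word_class_def pres_equiv_altdef)
  then have "(SOME v. v \<in> word_class S R w) \<in> word_class S R w"
    by (rule someI)
  then show ?thesis
    by (simp add: word_class_def)
qed

lemma mult_presented_group:
  assumes "u \<in> lists (UNIV \<times> S)" "v \<in> lists (UNIV \<times> S)"
  shows "word_class S R u \<otimes>\<^bsub>presented_group S R\<^esub> word_class S R v = word_class S R (u @ v)"
  using word_class_eqI[OF pres_equiv_append[OF some_word_class[OF assms(1)] some_word_class[OF assms(2)]]]
  by (simp add: presented_group_def word_class_def)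

lemma word_class_cancel:
  assumes "x \<in> S"
  shows "word_class S R [(b, x), (\<not> b, x)] = word_class S R []"
  using assms pres_step_cancel[of "[]" "[]" b x R] by (intro word_class_step[symmetric]) auto

lemma word_class_relator:
  assumes "r \<in> R" "r \<in> lists (UNIV \<times> S)"
  shows "word_class S R r = word_class S R []"
  using assms pres_step_relator[of r R "[]" "[]"] by (intro word_class_step[symmetric]) auto

lemma group_presented_group: "group (presented_group S R)"
proof (rule groupI)
  let ?P = "presented_group S R"
  show "\<exists>y\<in>carrier ?P. y \<otimes>\<^bsub>?P\<^esub> x = \<one>\<^bsub>?P\<^esub>" if x: "x \<in> carrier ?P" for x
  proof -
    have "\<exists>v\<in>lists (UNIV \<times> S). word_class S R (v @ w) = word_class S R []"
      if "w \<in> lists (UNIV \<times> S)" for w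
      using that
    proof (induction w)
      case Nil
      then show ?case by (intro bexI[of _ "[]"]) auto
    next
      case (Cons l w)
      then obtain v where v: "v \<in> lists (UNIV \<times> S)" "word_class S R (v @ w) = word_class S R []"
        by auto
      obtain b x where l: "l = (b, x)" "x \<in> S"
        using Cons by (cases l) auto
      \<comment> \<open>The left inverse of \<open>l # w\<close> is \<open>v\<close> followed by the
        inverse letter. The double negation makes the inserted pair an instance of
        \<open>pres_step_cancel\<close>.\<close>
      have "word_class S R (v @ w) = word_class S R (v @ [(\<not> b, x), (\<not> \<not> b, x)] @ w)"
        by (rule word_class_step[OF pres_step_cancel]) (use Cons v l in auto)
      then show ?case
        using v l Cons by (intro bexI[of _ "v @ [(\<not> b, x)]"]) auto
    qed
    moreover obtain w where w: "w \<in> lists (UNIV \<times> S)" "x = word_class S R w"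
      using x by (auto simp: carrier_presented_group)
    ultimately obtain v where "v \<in> lists (UNIV \<times> S)" "word_class S R (v @ w) = word_class S R []"
      by blast
    then show ?thesis
      using w by (intro bexI[of _ "word_class S R v"])
        (simp_all add: mult_presented_group one_presented_group carrier_presented_group)
  qed
qed (auto simp: carrier_presented_group one_presented_group mult_presented_group)

text \<open>Stated for arbitrary functions rather than homomorphisms, because primitives need not be
  additive. \<open>F\<close> evaluates \<open>f\<close> at a chosen representative, and invariance
  makes the choice immaterial.\<close>

lemma word_function_lift:
  assumes "\<And>u v. (u, v) \<in> pres_step R \<Longrightarrow> f u = f v"
  obtains F where "\<And>w. w \<in> lists (UNIV \<times> S) \<Longrightarrow> F (word_class S R w) = f w"
proof
  fix w :: "'a word" assume w: "w \<in> lists (UNIV \<times> S)"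
  have "f u = f v" if "(u, v) \<in> (pres_move S R)\<^sup>*" for u v
    using that by (induction rule: rtrancl_induct) (auto simp: pres_move_def dest: assms)
  then show "f (SOME v. v \<in> word_class S R w) = f w"
    using some_word_class[OF w, of R] by (auto simp: pres_equiv_altdef)
qed

section \<open>Characters and primitives of their cup products\<close>

text \<open>Rational values permit division by the index of the subgroup in the transfer
  argument.\<close>

definition additive_char :: "('a, 'm) monoid_scheme \<Rightarrow> ('a \<Rightarrow> rat) \<Rightarrow> bool" where
  "additive_char G x \<longleftrightarrow> (\<forall>u\<in>carrier G. \<forall>v\<in>carrier G. x (u \<otimes>\<^bsub>G\<^esub> v) = x u + x v)"

text \<open>For characters \<open>x\<close> and \<open>y\<close> this says that sending
  \<open>u\<close> to the unitriangular matrix with rows \<open>(1, x u, q u)\<close>,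
  \<open>(0, 1, y u)\<close>, \<open>(0, 0, 1)\<close> is a homomorphism to the rational Heisenberg
  group.\<close>

definition cup_primitive ::
  "('a, 'm) monoid_scheme \<Rightarrow> ('a \<Rightarrow> rat) \<Rightarrow> ('a \<Rightarrow> rat) \<Rightarrow> ('a \<Rightarrow> rat) \<Rightarrow> bool" where
  "cup_primitive G x y q \<longleftrightarrow>
     (\<forall>u\<in>carrier G. \<forall>v\<in>carrier G. q (u \<otimes>\<^bsub>G\<^esub> v) = q u + q v + x u * y v)"

lemma additive_char_restrict:
  "\<lbrakk>additive_char G x; H \<subseteq> carrier G\<rbrakk> \<Longrightarrow> additive_char (G\<lparr>carrier := H\<rparr>) x"
  by (simp add: additive_char_def subset_iff)

lemma additive_charD:
  "\<lbrakk>additive_char G x; u \<in> carrier G; v \<in> carrier G\<rbrakk> \<Longrightarrow> x (u \<otimes>\<^bsub>G\<^esub> v) = x u + x v"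
  by (simp add: additive_char_def)

lemma cup_primitiveD:
  "\<lbrakk>cup_primitive G x y q; u \<in> carrier G; v \<in> carrier G\<rbrakk>
    \<Longrightarrow> q (u \<otimes>\<^bsub>G\<^esub> v) = q u + q v + x u * y v"
  by (simp add: cup_primitive_def)

context group
begin

lemma additive_char_one: "additive_char G x \<Longrightarrow> x \<one> = 0"
  using additive_charD[of G x \<one> \<one>] by simp

lemma additive_char_inv:
  assumes "additive_char G x" "u \<in> carrier G"
  shows "x (inv u) = - x u"
  using additive_charD[OF assms(1,2), of "inv u"] additive_char_one[OF assms(1)] assms(2) by simp

lemma cup_primitive_one: "additive_char G x \<Longrightarrow> cup_primitive G x y q \<Longrightarrow> q \<one> = 0"
  using cup_primitiveD[of G x y q \<one> \<one>] additive_char_one[of x] by simp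

lemma cup_primitive_inv:
  assumes "additive_char G x" "additive_char G y" "cup_primitive G x y q" "u \<in> carrier G"
  shows "q (inv u) = x u * y u - q u"
  using cup_primitiveD[OF assms(3,4), of "inv u"] cup_primitive_one[OF assms(1,3)]
    additive_char_inv[OF assms(2,4)] assms(4) by simp

lemma group_commutator_closed:
  "\<lbrakk>a \<in> carrier G; b \<in> carrier G\<rbrakk> \<Longrightarrow> group_commutator G a b \<in> carrier G"
  by (simp add: group_commutator_def)

lemma additive_char_commutator:
  assumes "additive_char G x" "a \<in> carrier G" "b \<in> carrier G"
  shows "x (group_commutator G a b) = 0"
  using assms by (simp add: group_commutator_def additive_charD additive_char_inv)

text \<open>This is the upper right entry of a commutator of unitriangular matrices.\<close>

lemma cup_primitive_commutator:
  assumes "additive_char G x" "additive_char G y" "cup_primitive G x y q"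
    and "a \<in> carrier G" "b \<in> carrier G"
  shows "q (group_commutator G a b) = x a * y b - x b * y a"
  using assms
  by (simp add: group_commutator_def cup_primitiveD additive_charD additive_char_inv
      cup_primitive_inv algebra_simps)

section \<open>Normality of the lower central series and vanishing on its terms\<close>

lemma lcs_normal: "lcs G n \<lhd> G"
proof (induction n)
  case 0
  show ?case by (simp add: normal_invI subgroup_self)
next
  case (Suc n)
  interpret N: normal "lcs G n" G by (rule Suc)
  show ?case
    unfolding lcs.simps commutator_subgroup_def
  proof (rule normal_generateI)
    fix c g
    assume "c \<in> {group_commutator G h k |h k. h \<in> carrier G \<and> k \<in> lcs G n}" and g: "g \<in> carrier G"
    then obtain h k where hk: "h \<in> carrier G" "k \<in> lcs G n" and c: "c = group_commutator G h k"
      by blast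
    have k: "k \<in> carrier G" using hk by simp
    \<comment> \<open>A conjugate of a commutator is the commutator of the conjugates; this rule
      cancels the inner pairs left after reassociation.\<close>
    have "inv g \<otimes> (g \<otimes> z) = z" if "z \<in> carrier G" for z
      using that g by (simp flip: m_assoc)
    then have "g \<otimes> c \<otimes> inv g = group_commutator G (g \<otimes> h \<otimes> inv g) (g \<otimes> k \<otimes> inv g)"
      using g hk(1) k
      by (simp add: c group_commutator_def inv_mult_group m_assoc)
    moreover have "g \<otimes> k \<otimes> inv g \<in> lcs G n"
      using N.inv_op_closed2 g hk by blast
    ultimately show "g \<otimes> c \<otimes> inv g \<in> {group_commutator G h k |h k. h \<in> carrier G \<and> k \<in> lcs G n}"
      using g hk by blast
  qed (use group_commutator_closed in auto)
qed

lemma lcs_subset: "lcs G n \<subseteq> carrier G"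
  using normal_imp_subgroup[OF lcs_normal] subgroup.subset by blast

lemma additive_char_lcs:
  assumes "additive_char G x" "z \<in> lcs G (Suc n)"
  shows "x z = 0"
proof -
  have gen: "w \<in> carrier G \<and> x w = 0"
    if w: "w \<in> {group_commutator G h k |h k. h \<in> carrier G \<and> k \<in> lcs G n}" for w
  proof -
    obtain h k where hk: "h \<in> carrier G" "k \<in> lcs G n" "w = group_commutator G h k"
      using w by blast
    moreover from hk have "k \<in> carrier G" using lcs_subset by blast
    ultimately show ?thesis
      using assms(1) by (simp add: group_commutator_closed additive_char_commutator)
  qed
  have "z \<in> carrier G \<and> x z = 0"
    using assms(2) unfolding lcs.simps commutator_subgroup_def
  proof (induction rule: generate.induct)
    case (incl h)
    then show ?case by (rule gen)
  next
    case (inv h)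
    from gen[OF this] show ?case
      using assms(1) by (simp add: additive_char_inv)
  qed (use assms(1) in \<open>simp_all add: additive_char_one additive_charD\<close>)
  then show ?thesis ..
qed

text \<open>\<open>lcs\<close> counts from 0, so \<open>z\<close> lies in
  \<open>\<gamma>\<^sub>3\<close>. On a generating commutator of \<open>h\<close> and
  \<open>k\<close>, both characters vanish at \<open>k\<close>, which makes
  \<open>x h * y k - x k * y h\<close> zero.\<close>

lemma cup_primitive_lcs:
  assumes "additive_char G x" "additive_char G y" "cup_primitive G x y q"
    and "z \<in> lcs G (Suc (Suc n))"
  shows "q z = 0"
proof -
  have gen: "w \<in> carrier G \<and> x w = 0 \<and> y w = 0 \<and> q w = 0"
    if w: "w \<in> {group_commutator G h k |h k. h \<in> carrier G \<and> k \<in> lcs G (Suc n)}" for w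
  proof -
    obtain h k where hk: "h \<in> carrier G" "k \<in> lcs G (Suc n)" "w = group_commutator G h k"
      using w by blast
    moreover from hk have "k \<in> carrier G" using lcs_subset by blast
    ultimately show ?thesis
      using assms(1-3) additive_char_lcs[OF assms(1) hk(2)] additive_char_lcs[OF assms(2) hk(2)]
      by (simp add: group_commutator_closed additive_char_commutator cup_primitive_commutator)
  qed
  \<comment> \<open>The vanishing of \<open>x\<close> and \<open>y\<close> is carried along because
    \<open>q\<close> respects products and inverses only up to products of their values.\<close>
  have "z \<in> carrier G \<and> x z = 0 \<and> y z = 0 \<and> q z = 0"
    using assms(4) unfolding lcs.simps(2)[of G "Suc n"] commutator_subgroup_def
  proof (induction rule: generate.induct)
    case one
    show ?case
      using assms(1-3) by (simp add: additive_char_one cup_primitive_one)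
  next
    case (incl h)
    then show ?case by (rule gen)
  next
    case (inv h)
    from gen[OF this] show ?case
      using assms(1-3) by (simp add: additive_char_inv cup_primitive_inv)
  next
    case (eng h1 h2)
    then show ?case
      using assms(1-3) by (simp add: additive_charD cup_primitiveD)
  qed
  then show ?thesis by blast
qed

end

section \<open>Transfer from a subgroup of finite index\<close>

text \<open>Extend \<open>f\<close> to a function \<open>F\<close> on \<open>G\<close> by coset representatives. Its failure \<open>D u\<close> to be a
  primitive is invariant under left multiplication by \<open>H\<close>, and the average of \<open>D u\<close> over the
  cosets is the primitive on \<open>G\<close>.\<close>
lemma (in group) cup_primitive_transfer:
  assumes H: "subgroup H G" and fin: "finite (rcosets H)"
    and x: "additive_char G x" and y: "additive_char G y"
    and f: "cup_primitive (G\<lparr>carrier := H\<rparr>) x y f"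
  obtains q where "cup_primitive G x y q"
proof -
  interpret H: subgroup H G by (rule H)
  define rep where "rep C = (SOME t. t \<in> C)" for C :: "'a set"
  have rep: "rep C \<in> carrier G \<and> H #> rep C = C" if C: "C \<in> rcosets H" for C
  proof -
    obtain a where a: "a \<in> carrier G" "C = H #> a"
      using C unfolding RCOSETS_def by blast
    then have "rep C \<in> C"
      unfolding rep_def using rcos_self[OF a(1) H] by (metis someI)
    then show ?thesis
      using a repr_independence[OF _ a(1) H] H.elemrcos_carrier[OF is_group a(1)] by auto
  qed
  have rep_coset: "rep (H #> u) \<in> carrier G" "u \<otimes> inv (rep (H #> u)) \<in> H" if "u \<in> carrier G" for u
  proof -
    have C: "H #> u \<in> rcosets H"
      using that rcosetsI H.subset by blast
    then show 1: "rep (H #> u) \<in> carrier G" using rep by blast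
    have "u \<in> H #> rep (H #> u)"
      using rep[OF C] rcos_self[OF that H] by simp
    then show "u \<otimes> inv (rep (H #> u)) \<in> H"
      using H.rcos_module_imp[OF is_group 1] by blast
  qed
  \<comment> \<open>For \<open>u\<close> written as \<open>k \<otimes> t\<close> with
    \<open>k\<close> in \<open>H\<close> and \<open>t\<close> the representative, this is the value
    that the primitive equation forces once \<open>t\<close> is sent to 0.\<close>
  define F where
    "F u = (let t = rep (H #> u) in f (u \<otimes> inv t) + x (u \<otimes> inv t) * y t)" for u
  have F_left: "F (h \<otimes> u) = f h + F u + x h * y u" if h: "h \<in> H" and u: "u \<in> carrier G" for h u
  proof -
    define t where "t = rep (H #> u)"
    define k where "k = u \<otimes> inv t"
    have t: "t \<in> carrier G" and k: "k \<in> H"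
      using rep_coset[OF u] by (auto simp: t_def k_def)
    have kc: "k \<in> carrier G" and hc: "h \<in> carrier G" using k h by auto
    have "H #> (h \<otimes> u) = H #> u"
      using h u coset_mult_assoc[OF H.subset hc u] H.rcos_const[OF is_group h] by simp
    moreover have "h \<otimes> u \<otimes> inv t = h \<otimes> k"
      using hc u t by (simp add: k_def m_assoc)
    moreover have "y u = y k + y t"
      using additive_charD[OF y kc t] u t by (simp add: k_def m_assoc)
    ultimately show ?thesis
      using cup_primitiveD[OF f, of h k] h k additive_charD[OF x hc kc]
      by (simp add: F_def Let_def flip: t_def k_def) (simp add: algebra_simps flip: k_def)
  qed
  \<comment> \<open>If \<open>F\<close> were a primitive on \<open>G\<close>, \<open>D u a\<close>
    would equal \<open>F u\<close> for every \<open>a\<close>.\<close>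
  define D where "D u a = F (a \<otimes> u) - F a - x a * y u" for u a
  have D_left: "D u (h \<otimes> a) = D u a" if "h \<in> H" "a \<in> carrier G" "u \<in> carrier G" for h a u
    using that F_left[of h "a \<otimes> u"] F_left[of h a] additive_charD[OF x, of h a]
      additive_charD[OF y, of a u]
    by (simp add: D_def m_assoc algebra_simps)
  have D_coset: "D u a = D u (rep (H #> a))" if "a \<in> carrier G" "u \<in> carrier G" for a u
    using D_left[OF rep_coset(2)[OF that(1)] rep_coset(1)[OF that(1)] that(2)] that rep_coset(1)
    by (simp add: m_assoc)
  \<comment> \<open>This is the primitive equation except for the shift from \<open>a\<close> to
    \<open>a \<otimes> u\<close>. The shift disappears on summing over the cosets, which right
    multiplication by \<open>u\<close> permutes.\<close>
  have D_mult: "D (u \<otimes> v) a = D v (a \<otimes> u) + D u a + x u * y v"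
    if "a \<in> carrier G" "u \<in> carrier G" "v \<in> carrier G" for a u v
    using that additive_charD[OF y, of u v] additive_charD[OF x, of a u]
    by (simp add: D_def m_assoc algebra_simps)
  define q where "q u = (\<Sum>C\<in>rcosets H. D u (rep C)) / of_nat (card (rcosets H))" for u
  have "H #> \<one> \<in> rcosets H" using rcosetsI[OF H.subset] by blast
  then have pos: "card (rcosets H) \<noteq> 0" using fin by auto
  have "q (u \<otimes> v) = q u + q v + x u * y v" if u: "u \<in> carrier G" and v: "v \<in> carrier G" for u v
  proof -
    have shift: "C #> a \<in> rcosets H" if "C \<in> rcosets H" "a \<in> carrier G" for C a
      using that coset_mult_assoc[OF H.subset] rcosetsI[OF H.subset] unfolding RCOSETS_def by auto
    have undo: "C #> a #> b = C" if "C \<in> rcosets H" "a \<in> carrier G" "b \<in> carrier G" "a \<otimes> b = \<one>"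
      for C a b
    proof -
      have "C \<subseteq> carrier G" using that rcosets_part_G[OF H] by blast
      then show ?thesis using that by (simp add: coset_mult_assoc coset_mult_one)
    qed
    have "(\<Sum>C\<in>rcosets H. D v (rep C \<otimes> u)) = (\<Sum>C\<in>rcosets H. D v (rep (C #> u)))"
    proof (rule sum.cong)
      fix C assume C: "C \<in> rcosets H"
      have "H #> (rep C \<otimes> u) = C #> u"
        using rep[OF C] coset_mult_assoc[OF H.subset, of "rep C" u] u by simp
      then show "D v (rep C \<otimes> u) = D v (rep (C #> u))"
        using D_coset[of "rep C \<otimes> u" v] rep[OF C] u v by simp
    qed simp
    also have "\<dots> = (\<Sum>C\<in>rcosets H. D v (rep C))"
      by (rule sum.reindex_bij_witness[where i = "\<lambda>C. C #> inv u" and j = "\<lambda>C. C #> u"])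
        (use u shift undo in auto)
    finally have reindex: "(\<Sum>C\<in>rcosets H. D v (rep C \<otimes> u)) = (\<Sum>C\<in>rcosets H. D v (rep C))" .
    have "(\<Sum>C\<in>rcosets H. D (u \<otimes> v) (rep C)) =
        (\<Sum>C\<in>rcosets H. D v (rep C \<otimes> u) + D u (rep C) + x u * y v)"
      by (rule sum.cong) (use rep u v D_mult in auto)
    also have "\<dots> = (\<Sum>C\<in>rcosets H. D v (rep C)) + (\<Sum>C\<in>rcosets H. D u (rep C))
        + of_nat (card (rcosets H)) * (x u * y v)"
      by (simp add: sum.distrib reindex)
    finally show ?thesis
      using pos by (simp add: q_def field_simps)
  qed
  then show thesis
    using that[of q] by (simp add: cup_primitive_def)
qed

section \<open>Characters and primitives on words\<close>

fun word_char :: "('a \<Rightarrow> rat) \<Rightarrow> 'a word \<Rightarrow> rat" where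
  "word_char c [] = 0"
| "word_char c ((b, s) # w) = (if b then c s else - c s) + word_char c w"

text \<open>The value \<open>c s * d s\<close> on an inverse letter is the one forced by invariance under cancellation
  once generators are sent to 0.\<close>
fun word_primitive :: "('a \<Rightarrow> rat) \<Rightarrow> ('a \<Rightarrow> rat) \<Rightarrow> 'a word \<Rightarrow> rat" where
  "word_primitive c d [] = 0"
| "word_primitive c d ((b, s) # w) =
     (if b then 0 else c s * d s) + word_primitive c d w + (if b then c s else - c s) * word_char d w"

lemma word_char_append: "word_char c (u @ v) = word_char c u + word_char c v"
  by (induction c u rule: word_char.induct) auto

lemma word_primitive_append:
  "word_primitive c d (u @ v) =
     word_primitive c d u + word_primitive c d v + word_char c u * word_char d v"
  by (induction c d u rule: word_primitive.induct) (auto simp: word_char_append algebra_simps)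

lemma word_char_step:
  assumes "(u, v) \<in> pres_step R" "\<And>r. r \<in> R \<Longrightarrow> word_char c r = 0"
  shows "word_char c u = word_char c v"
  using assms by (auto simp: pres_step_def word_char_append)

text \<open>Freeness enters through the empty relator set: a cancelling pair contributes 0, whereas
  a relator could contribute a nonzero value.\<close>

lemma word_primitive_step:
  "(u, v) \<in> pres_step {} \<Longrightarrow> word_primitive c d u = word_primitive c d v"
  by (auto simp: pres_step_def word_char_append word_primitive_append algebra_simps)

lemma presented_group_char:
  assumes "\<And>r. r \<in> R \<Longrightarrow> word_char c r = 0"
  obtains x where "additive_char (presented_group S R) x"
    and "\<And>w. w \<in> lists (UNIV \<times> S) \<Longrightarrow> x (word_class S R w) = word_char c w"
proof -
  obtain x where x: "\<And>w. w \<in> lists (UNIV \<times> S) \<Longrightarrow> x (word_class S R w) = word_char c w"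
    using word_function_lift[of R "word_char c" S] word_char_step[of _ _ R c] assms by metis
  then have "additive_char (presented_group S R) x"
    by (auto simp: additive_char_def carrier_presented_group mult_presented_group word_char_append)
  with x that show thesis by blast
qed

text \<open>Lets an arbitrary character enter the word formulas. An inverse letter gets the negative
  value because a cancelling pair is trivial in the group.\<close>

lemma additive_char_word_class:
  assumes x: "additive_char (presented_group S R) x" and w: "w \<in> lists (UNIV \<times> S)"
  shows "x (word_class S R w) = word_char (\<lambda>s. x (word_class S R [(True, s)])) w"
  using w
proof (induction w)
  case Nil
  show ?case
    using group.additive_char_one[OF group_presented_group x] by (simp add: one_presented_group)
next
  case (Cons l w)
  obtain b s where l: "l = (b, s)" "s \<in> S"
    using Cons by (cases l) auto
  have letter: "x (word_class S R ([(b, s)] @ v)) = x (word_class S R [(b, s)]) + x (word_class S R v)"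
    if "v \<in> lists (UNIV \<times> S)" for b v
    using additive_charD[OF x, of "word_class S R [(b, s)]" "word_class S R v"] that l
    by (simp add: mult_presented_group carrier_presented_group)
  have "x (word_class S R [(True, s), (\<not> True, s)]) = 0"
    using word_class_cancel[OF l(2), of R True] group.additive_char_one[OF group_presented_group x]
    by (simp add: one_presented_group)
  then have "x (word_class S R [(False, s)]) = - x (word_class S R [(True, s)])"
    using letter[of "[(False, s)]" True] l by simp
  then show ?case
    using letter[of w b] Cons l by simp
qed

text \<open>Cup products of characters of a free group vanish in cohomology;
  \<open>word_primitive\<close> supplies the explicit primitive that sends every generator to
  0.\<close>

lemma free_group_cup_primitive:
  assumes x: "additive_char (free_group S) x" and y: "additive_char (free_group S) y"
  obtains f where "cup_primitive (free_group S) x y f"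
proof -
  define c where "c s = x (word_class S {} [(True, s)])" for s
  define d where "d s = y (word_class S {} [(True, s)])" for s
  obtain f where f: "\<And>w. w \<in> lists (UNIV \<times> S) \<Longrightarrow> f (word_class S {} w) = word_primitive c d w"
    using word_function_lift[of "{}" "word_primitive c d" S] word_primitive_step[of _ _ c d] by metis
  have "x (word_class S {} w) = word_char c w" "y (word_class S {} w) = word_char d w"
    if "w \<in> lists (UNIV \<times> S)" for w
    using additive_char_word_class[OF _ that, of "{}" x] additive_char_word_class[OF _ that, of "{}" y] x y
    unfolding c_def d_def free_group_def by auto
  with f have "cup_primitive (free_group S) x y f"
    by (auto simp: cup_primitive_def free_group_def carrier_presented_group mult_presented_group
        word_primitive_append)
  then show thesis by (rule that)
qed

lemma cup_primitive_iso_free_group: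
  assumes "group H" "H \<cong> free_group S" and x: "additive_char H x" and y: "additive_char H y"
  obtains f where "cup_primitive H x y f"
proof -
  obtain \<phi> where \<phi>: "\<phi> \<in> iso H (free_group S)"
    using assms(2) by (auto simp: is_iso_def)
  define \<psi> where "\<psi> = inv_into (carrier H) \<phi>"
  have \<psi>: "\<psi> \<in> hom (free_group S) H"
    using group.iso_set_sym[OF assms(1) \<phi>] by (simp add: \<psi>_def iso_def)
  have "additive_char (free_group S) (x \<circ> \<psi>)" "additive_char (free_group S) (y \<circ> \<psi>)"
    using x y hom_mult[OF \<psi>] hom_in_carrier[OF \<psi>] by (simp_all add: additive_char_def)
  then obtain f where f: "cup_primitive (free_group S) (x \<circ> \<psi>) (y \<circ> \<psi>) f"
    by (rule free_group_cup_primitive)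
  have "\<psi> (\<phi> u) = u" if "u \<in> carrier H" for u
    using \<phi> that by (simp add: \<psi>_def iso_def bij_betw_def)
  moreover have "\<phi> \<in> hom H (free_group S)"
    using \<phi> by (simp add: iso_def)
  ultimately have "cup_primitive H x y (f \<circ> \<phi>)"
    using f by (auto simp: cup_primitive_def hom_mult hom_in_carrier)
  then show thesis by (rule that)
qed

section \<open>Products of commutators\<close>

text \<open>Indexing by a list allows induction parallel to the \<open>concat\<close> and
  \<open>map\<close> form of \<open>surface_relator\<close>.\<close>

definition comm_prod :: "('a, 'm) monoid_scheme \<Rightarrow> (nat \<Rightarrow> 'a) \<Rightarrow> (nat \<Rightarrow> 'a) \<Rightarrow> nat list \<Rightarrow> 'a" where
  "comm_prod G a b is = foldr (\<lambda>i p. group_commutator G (a i) (b i) \<otimes>\<^bsub>G\<^esub> p) is \<one>\<^bsub>G\<^esub>"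

lemma comm_prod_Nil: "comm_prod G a b [] = \<one>\<^bsub>G\<^esub>"
  and comm_prod_Cons:
    "comm_prod G a b (i # is) = group_commutator G (a i) (b i) \<otimes>\<^bsub>G\<^esub> comm_prod G a b is"
  by (simp_all add: comm_prod_def)

lemma (in group) comm_prod_closed:
  assumes "\<And>i. i \<in> set is \<Longrightarrow> a i \<in> carrier G" "\<And>i. i \<in> set is \<Longrightarrow> b i \<in> carrier G"
  shows "comm_prod G a b is \<in> carrier G"
  using assms by (induction "is") (auto simp: comm_prod_Nil comm_prod_Cons group_commutator_closed)

lemma (in group_hom) hom_comm_prod:
  assumes "\<And>i. i \<in> set is \<Longrightarrow> a i \<in> carrier G" "\<And>i. i \<in> set is \<Longrightarrow> b i \<in> carrier G"
  shows "h (comm_prod G a b is) = comm_prod H (h \<circ> a) (h \<circ> b) is"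
  using assms
  by (induction "is")
    (auto simp: comm_prod_Nil comm_prod_Cons G.group_commutator_closed G.comm_prod_closed,
     simp add: group_commutator_def)

lemma comm_prod_cong:
  assumes "\<And>i. i \<in> set is \<Longrightarrow> a i = a' i" "\<And>i. i \<in> set is \<Longrightarrow> b i = b' i"
  shows "comm_prod G a b is = comm_prod G a' b' is"
  using assms by (induction "is") (auto simp: comm_prod_Nil comm_prod_Cons)

text \<open>Since \<open>x\<close> vanishes on each commutator, the cross terms are 0 and
  \<open>q\<close> adds over the factors.\<close>

lemma (in group) cup_primitive_comm_prod:
  assumes x: "additive_char G x" and y: "additive_char G y" and q: "cup_primitive G x y q"
    and "\<And>i. i \<in> set is \<Longrightarrow> a i \<in> carrier G" "\<And>i. i \<in> set is \<Longrightarrow> b i \<in> carrier G"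
  shows "q (comm_prod G a b is) = (\<Sum>i\<leftarrow>is. x (a i) * y (b i) - x (b i) * y (a i))"
  using assms(4,5)
proof (induction "is")
  case Nil
  show ?case by (simp add: comm_prod_Nil cup_primitive_one[OF x q])
next
  case (Cons i "is")
  then show ?case
    by (simp add: comm_prod_Cons cup_primitiveD[OF q] comm_prod_closed group_commutator_closed
        additive_char_commutator[OF x] cup_primitive_commutator[OF x y q])
qed

section \<open>Surface groups\<close>

definition surface_gen :: "nat \<Rightarrow> nat \<Rightarrow> nat word set" where
  "surface_gen g s = word_class {..<2*g} {surface_relator g} [(True, s)]"

lemma group_surface_group: "group (surface_group g)"
  by (simp add: surface_group_def group_presented_group)

lemma surface_gen_closed: "s < 2 * g \<Longrightarrow> surface_gen g s \<in> carrier (surface_group g)"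
  by (simp add: surface_gen_def surface_group_def carrier_presented_group)

text \<open>Every generator has exponent sum 0 in the relator, so values on the generators can be
  prescribed freely.\<close>

lemma surface_group_char:
  obtains x where "additive_char (surface_group g) x" "\<And>s. s < 2 * g \<Longrightarrow> x (surface_gen g s) = c s"
proof -
  have "word_char c (concat (map (\<lambda>i. [(True, 2*i), (True, 2*i+1), (False, 2*i), (False, 2*i+1)]) is)) = 0"
    for "is" :: "nat list"
    by (induction "is") (auto simp: word_char_append)
  then have "word_char c r = 0" if "r \<in> {surface_relator g}" for r
    using that by (simp add: surface_relator_def)
  then obtain x where "additive_char (surface_group g) x"
    "\<And>w. w \<in> lists (UNIV \<times> {..<2*g}) \<Longrightarrow>
       x (word_class {..<2*g} {surface_relator g} w) = word_char c w"
    unfolding surface_group_def using presented_group_char by metis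
  then show thesis
    by (intro that) (auto simp: surface_gen_def)
qed

lemma surface_group_relation:
  "comm_prod (surface_group g) (\<lambda>i. surface_gen g (2*i)) (\<lambda>i. surface_gen g (2*i+1)) [0..<g]
     = \<one>\<^bsub>surface_group g\<^esub>"
proof -
  let ?S = "{..<2*g}" and ?R = "{surface_relator g}"
  interpret group "surface_group g" by (rule group_surface_group)
  have inv: "inv\<^bsub>surface_group g\<^esub> surface_gen g s = word_class ?S ?R [(False, s)]" if "s < 2*g" for s
  proof (rule inv_equality)
    show "word_class ?S ?R [(False, s)] \<otimes>\<^bsub>surface_group g\<^esub> surface_gen g s = \<one>\<^bsub>surface_group g\<^esub>"
      using that word_class_cancel[of s ?S ?R False]
      by (simp add: surface_gen_def surface_group_def mult_presented_group one_presented_group)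
    show "word_class ?S ?R [(False, s)] \<in> carrier (surface_group g)"
      using that by (simp add: surface_group_def carrier_presented_group)
  qed (use that surface_gen_closed in auto)
  let ?rel = "\<lambda>i. [(True, 2*i), (True, 2*i+1), (False, 2*i), (False, 2*i+1)] :: nat word"
  have comm: "group_commutator (surface_group g) (surface_gen g (2*i)) (surface_gen g (2*i+1))
      = word_class ?S ?R (?rel i)" if "i < g" for i
    using that unfolding group_commutator_def
    by (simp add: inv) (simp add: surface_gen_def surface_group_def mult_presented_group)
  have words: "concat (map ?rel is) \<in> lists (UNIV \<times> ?S)" if "set is \<subseteq> {..<g}" for "is"
    using that by (induction "is") auto
  \<comment> \<open>Generalised from \<open>[0..<g]\<close> to any list of admissible indices, so
    that induction applies.\<close>
  have "comm_prod (surface_group g) (\<lambda>i. surface_gen g (2*i)) (\<lambda>i. surface_gen g (2*i+1)) is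
      = word_class ?S ?R (concat (map ?rel is))" if "set is \<subseteq> {..<g}" for "is"
    using that
  proof (induction "is")
    case Nil
    show ?case by (simp add: comm_prod_Nil surface_group_def one_presented_group)
  next
    case (Cons i "is")
    have "word_class ?S ?R (?rel i) \<otimes>\<^bsub>surface_group g\<^esub> word_class ?S ?R (concat (map ?rel is))
        = word_class ?S ?R (?rel i @ concat (map ?rel is))"
      unfolding surface_group_def using Cons words[of "is"]
      by (intro mult_presented_group) auto
    then show ?case
      using Cons comm[of i] by (simp add: comm_prod_Cons)
  qed
  from this[of "[0..<g]"]
  have "comm_prod (surface_group g) (\<lambda>i. surface_gen g (2*i)) (\<lambda>i. surface_gen g (2*i+1)) [0..<g]
      = word_class ?S ?R (surface_relator g)"
    by (simp add: surface_relator_def subset_eq)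
  also have "\<dots> = \<one>\<^bsub>surface_group g\<^esub>"
    using words[of "[0..<g]"]
    by (simp add: subset_eq surface_group_def one_presented_group word_class_relator surface_relator_def)
  finally show ?thesis .
qed

section \<open>Lifting along an isomorphism of quotients\<close>

lemma (in group) additive_char_coset:
  assumes N: "subgroup N G" and x: "additive_char G x" and van: "\<And>z. z \<in> N \<Longrightarrow> x z = 0"
    and uv: "u \<in> carrier G" "v \<in> carrier G" "N #> u = N #> v"
  shows "x u = x v"
proof -
  obtain z where "z \<in> N" "u = z \<otimes> v"
    using rcos_self[OF uv(1) N] uv(3) by (auto simp: r_coset_def)
  then show ?thesis
    using additive_charD[OF x, of z v] van subgroup.subset[OF N] uv by auto
qed

text \<open>\<open>x'\<close> is \<open>x\<close> applied to chosen lifts of the images under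
  \<open>\<phi>\<close>. The choice need not be multiplicative, but \<open>x\<close> is constant on
  cosets of \<open>N\<close> and does not see the difference.\<close>

lemma additive_char_pullback:
  assumes "group G" "group K" "M \<lhd> G" "N \<lhd> K" and \<phi>: "\<phi> \<in> hom (G Mod M) (K Mod N)"
    and x: "additive_char K x" and van: "\<And>z. z \<in> N \<Longrightarrow> x z = 0"
  obtains x' where "additive_char G x'"
    and "\<And>u v. \<lbrakk>u \<in> carrier G; v \<in> carrier K; \<phi> (M #>\<^bsub>G\<^esub> u) = N #>\<^bsub>K\<^esub> v\<rbrakk> \<Longrightarrow> x' u = x v"
proof -
  interpret G: group G by fact
  interpret K: group K by fact
  interpret M: normal M G by fact
  interpret N: normal N K by fact
  have "\<exists>v. v \<in> carrier K \<and> \<phi> (M #>\<^bsub>G\<^esub> u) = N #>\<^bsub>K\<^esub> v" if "u \<in> carrier G" for u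
  proof -
    have "\<phi> (M #>\<^bsub>G\<^esub> u) \<in> carrier (K Mod N)"
      using that by (intro hom_in_carrier[OF \<phi>]) (simp add: carrier_FactGroup)
    then show ?thesis by (auto simp: carrier_FactGroup)
  qed
  then obtain s where s: "s u \<in> carrier K" "\<phi> (M #>\<^bsub>G\<^esub> u) = N #>\<^bsub>K\<^esub> s u" if "u \<in> carrier G" for u
    by metis
  have eq: "x (s u) = x v" if "u \<in> carrier G" "v \<in> carrier K" "\<phi> (M #>\<^bsub>G\<^esub> u) = N #>\<^bsub>K\<^esub> v" for u v
    using that s by (intro K.additive_char_coset[OF N.subgroup_axioms x van]) auto
  have "\<phi> (M #>\<^bsub>G\<^esub> (u \<otimes>\<^bsub>G\<^esub> v)) = N #>\<^bsub>K\<^esub> (s u \<otimes>\<^bsub>K\<^esub> s v)" if "u \<in> carrier G" "v \<in> carrier G" for u v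
    using that s hom_mult[OF \<phi>, of "M #>\<^bsub>G\<^esub> u" "M #>\<^bsub>G\<^esub> v"]
    by (simp add: carrier_FactGroup M.rcos_sum N.rcos_sum)
  then have "additive_char G (\<lambda>u. x (s u))"
    using s eq additive_charD[OF x] unfolding additive_char_def
    by (metis G.m_closed K.m_closed)
  then show thesis
    using eq by (rule that)
qed

section \<open>Contradiction from a free subgroup of finite index\<close>

theorem theorem8:
  fixes g :: nat and G :: "('g, 'm) monoid_scheme"
  assumes "g \<ge> 2"
    and "group G"
    and "residually_nilpotent G"
    and "\<forall>k\<ge>1. G Mod (gamma G k) \<cong> surface_group g Mod (gamma (surface_group g) k)"
  shows "\<not> (\<exists>H. subgroup H G \<and> finite (rcosets\<^bsub>G\<^esub> H)
               \<and> (\<exists>S :: 'g set. G\<lparr>carrier := H\<rparr> \<cong> free_group S))"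
proof
  assume "\<exists>H. subgroup H G \<and> finite (rcosets\<^bsub>G\<^esub> H)
               \<and> (\<exists>S :: 'g set. G\<lparr>carrier := H\<rparr> \<cong> free_group S)"
  then obtain H and S :: "'g set" where H: "subgroup H G" "finite (rcosets\<^bsub>G\<^esub> H)"
    and free: "G\<lparr>carrier := H\<rparr> \<cong> free_group S" by blast
  let ?K = "surface_group g"
  \<comment> \<open>With \<open>lcs\<close> counted from 0, \<open>M\<close> and \<open>N\<close>
    are the terms \<open>\<gamma>\<^sub>3\<close>; hence the instance \<open>k = 3\<close> of the
    hypothesis below.\<close>
  define M where "M = lcs G (Suc (Suc 0))"
  define N where "N = lcs ?K (Suc (Suc 0))"
  interpret G: group G by fact
  interpret K: group ?K by (rule group_surface_group)
  interpret M: normal M G unfolding M_def by (rule G.lcs_normal)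
  interpret N: normal N ?K unfolding N_def by (rule K.lcs_normal)
  have "G Mod M \<cong> ?K Mod N"
    using assms(4)[rule_format, of 3] by (simp add: M_def N_def gamma_def numeral_3_eq_3)
  then obtain \<phi> where \<phi>: "\<phi> \<in> hom (G Mod M) (?K Mod N)"
    and bij: "bij_betw \<phi> (carrier (G Mod M)) (carrier (?K Mod N))"
    by (auto simp: is_iso_def iso_def)

  define \<psi> where "\<psi> = (\<lambda>u. \<phi> (M #>\<^bsub>G\<^esub> u))"
  have "\<psi> \<in> hom G (?K Mod N)"
    using hom_compose[OF M.r_coset_hom_Mod \<phi>] by (simp add: \<psi>_def comp_def)
  then interpret \<psi>: group_hom G "?K Mod N" \<psi>
    by (simp add: group_hom_def group_hom_axioms_def N.factorgroup_is_group)
  interpret \<pi>: group_hom ?K "?K Mod N" "\<lambda>v. N #>\<^bsub>?K\<^esub> v"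
    by (simp add: group_hom_def group_hom_axioms_def N.factorgroup_is_group N.r_coset_hom_Mod)

  \<comment> \<open>Surjectivity of \<open>\<phi>\<close> lifts the class of each surface generator
    to \<open>G\<close>.\<close>
  have "\<exists>u. u \<in> carrier G \<and> \<psi> u = N #>\<^bsub>?K\<^esub> surface_gen g s" if "s < 2 * g" for s
  proof -
    have "N #>\<^bsub>?K\<^esub> surface_gen g s \<in> \<phi> ` carrier (G Mod M)"
      using bij surface_gen_closed[OF that] by (simp add: bij_betw_def carrier_FactGroup)
    then show ?thesis by (auto simp: carrier_FactGroup \<psi>_def)
  qed
  then obtain e where e: "e s \<in> carrier G" "\<psi> (e s) = N #>\<^bsub>?K\<^esub> surface_gen g s" if "s < 2 * g" for s
    by metis
  define a where "a i = e (2 * i)" for i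
  define b where "b i = e (2 * i + 1)" for i
  define p where "p = comm_prod G a b [0..<g]"
  have ab: "a i \<in> carrier G" "b i \<in> carrier G" if "i \<in> set [0..<g]" for i
    using that e(1) by (auto simp: a_def b_def)
  have p: "p \<in> carrier G"
    unfolding p_def using ab by (rule G.comm_prod_closed)
  \<comment> \<open>\<open>\<psi>\<close> carries \<open>p\<close> to the class of the surface
    relator, which is trivial; injectivity of \<open>\<phi>\<close> then puts \<open>p\<close> in
    \<open>M\<close>.\<close>
  have "\<psi> p = comm_prod (?K Mod N) (\<psi> \<circ> a) (\<psi> \<circ> b) [0..<g]"
    unfolding p_def using ab by (rule \<psi>.hom_comm_prod)
  also have "\<dots> = comm_prod (?K Mod N) ((\<lambda>v. N #>\<^bsub>?K\<^esub> v) \<circ> (\<lambda>i. surface_gen g (2*i)))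
      ((\<lambda>v. N #>\<^bsub>?K\<^esub> v) \<circ> (\<lambda>i. surface_gen g (2*i+1))) [0..<g]"
    by (rule comm_prod_cong) (use e(2) in \<open>auto simp: a_def b_def\<close>)
  also have "\<dots> = N #>\<^bsub>?K\<^esub>
      comm_prod ?K (\<lambda>i. surface_gen g (2*i)) (\<lambda>i. surface_gen g (2*i+1)) [0..<g]"
    by (rule \<pi>.hom_comm_prod[symmetric]) (auto intro: surface_gen_closed)
  also have "\<dots> = \<one>\<^bsub>?K Mod N\<^esub>"
    unfolding surface_group_relation by (rule \<pi>.hom_one)
  finally have "\<psi> p = \<psi> \<one>\<^bsub>G\<^esub>" by simp
  then have "M #>\<^bsub>G\<^esub> p = M #>\<^bsub>G\<^esub> \<one>\<^bsub>G\<^esub>"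
    using bij p unfolding \<psi>_def bij_betw_def carrier_FactGroup
    by (metis G.one_closed imageI inj_onD)
  then have pM: "p \<in> lcs G (Suc (Suc 0))"
    using G.rcos_self[OF p M.subgroup_axioms] G.coset_mult_one[OF M.subset] by (simp add: M_def)

  \<comment> \<open>Characters of the surface group vanish on \<open>N\<close>, so they pull back
    along \<open>\<phi>\<close>; their values on the lifted generators remain free to
    prescribe.\<close>
  have char: "\<exists>x. additive_char G x \<and> (\<forall>s<2*g. x (e s) = c s)" for c
  proof -
    obtain x where x: "additive_char ?K x" "\<And>s. s < 2 * g \<Longrightarrow> x (surface_gen g s) = c s"
      using surface_group_char by blast
    have "x z = 0" if "z \<in> N" for z
      using that K.additive_char_lcs[OF x(1)] by (simp only: N_def)
    then obtain x' where "additive_char G x'"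
      "\<And>u v. \<lbrakk>u \<in> carrier G; v \<in> carrier ?K; \<phi> (M #>\<^bsub>G\<^esub> u) = N #>\<^bsub>?K\<^esub> v\<rbrakk> \<Longrightarrow> x' u = x v"
      using additive_char_pullback[OF G.is_group K.is_group M.normal_axioms N.normal_axioms \<phi> x(1)]
      by blast
    then show ?thesis
      using e x(2) surface_gen_closed unfolding \<psi>_def by metis
  qed
  \<comment> \<open>Generators 0 and 1 form the first commutator of the relator; \<open>x\<close>
    and \<open>y\<close> are the characters dual to them.\<close>
  obtain x where x: "additive_char G x" "\<And>s. s < 2*g \<Longrightarrow> x (e s) = (if s = 0 then 1 else 0)"
    using char[of "\<lambda>s. if s = 0 then 1 else 0"] by auto
  obtain y where y: "additive_char G y" "\<And>s. s < 2*g \<Longrightarrow> y (e s) = (if s = 1 then 1 else 0)"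
    using char[of "\<lambda>s. if s = 1 then 1 else 0"] by auto

  have "additive_char (G\<lparr>carrier := H\<rparr>) x" "additive_char (G\<lparr>carrier := H\<rparr>) y"
    using x(1) y(1) subgroup.subset[OF H(1)] by (auto intro: additive_char_restrict)
  then obtain f where "cup_primitive (G\<lparr>carrier := H\<rparr>) x y f"
    using cup_primitive_iso_free_group[OF G.subgroup_imp_group[OF H(1)] free] by blast
  then obtain q where q: "cup_primitive G x y q"
    using G.cup_primitive_transfer[OF H x(1) y(1)] by blast

  \<comment> \<open>Only index 0 contributes, through \<open>x (a 0) * y (b 0) = 1\<close>; it
    occurs in the list because \<open>g\<close> is positive.\<close>
  have "q p = (\<Sum>i\<leftarrow>[0..<g]. x (a i) * y (b i) - x (b i) * y (a i))"
    unfolding p_def using ab by (rule G.cup_primitive_comm_prod[OF x(1) y(1) q])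
  also have "\<dots> = (\<Sum>i\<leftarrow>[0..<g]. if i = 0 then 1 else 0)"
    by (intro arg_cong[of _ _ sum_list] map_cong)
      (auto simp: a_def b_def x(2) y(2))
  also have "\<dots> = 1"
    using assms(1) by (simp add: sum_list_distinct_conv_sum_set)
  finally show False
    using G.cup_primitive_lcs[OF x(1) y(1) q pM] by simp
qed

end
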